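(* $\vec{\chi}(\mathrm{Forb}_{\mathrm{ind}}(\overset{\leftrightarrow}{K}_2,P^+(1,1,1),\vec{K}_3))=2.$
   Context: All digraphs are finite and simple: no loops, and between two vertices at most one arc in each direction (so pairs of opposite arcs are allowed in general). $(u,v)$ denotes an arc with tail $u$ and head $v$. An acyclic $k$-coloring of a digraph $D$ is a map $c:V(D)\to S$ with $|S|=k$ such that each color class $c^{-1}(i)$, $i \in S$, induces a subdigraph without directed cycles (a digon, i.e. a pair of opposite arcs $(x,y),(y,x)$, counts as a directed cycle of length two). The dichromatic number $\vec{\chi}(D)$ is the smallest $k$ for which an acyclic $k$-coloring of $D$ exists. For a set (or list) $\mathcal{F}$ of digraphs, $\mathrm{Forb}_{\mathrm{ind}}(\mathcal{F})$ is the set of digraphs containing no induced subdigraph isomorphic to a member of $\mathcal{F}$. When the digraphs in this class have bounded dichromatic number, $\vec{\chi}(\mathrm{Forb}_{\mathrm{ind}}(\mathcal{F})):=\max\{\vec{\chi}(D) \mid D\in \mathrm{Forb}_{\mathrm{ind}}(\mathcal{F})\}$; an equality for this quantity includes the assertion that it is well defined. $\overset{\leftrightarrow}{K}_2$ is the digon: two vertices joined by arcs in both directions. $\vec{K}_3$ is the transitive tournament on $3$ vertices. $P^+(1,1,1)$ is the orientation of the path on four vertices consisting of three alternatingly oriented arcs, i.e. the digraph with vertices $a,b,c,d$ and arcs $(a,b),(c,b),(c,d)$. *)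

theory Defs
  imports "Graph_Theory.Digraph_Isomorphism"
begin

text \<open>
  The locale \<^locale>\<open>digraph\<close> provides the finite simple digraphs: finitely many vertices and arcs,
  no loops, no parallel arcs, while pairs of opposite arcs are allowed. The null digraph is included;
  its dichromatic number is 0.
\<close>

text \<open>
  \<^const>\<open>pre_digraph.cycle\<close> is a nonempty closed directed walk without repeated vertices;
  a pair of opposite arcs is such a cycle, of length two.
\<close>

definition acyclic_coloring :: "('a, 'b) pre_digraph \<Rightarrow> 'c set \<Rightarrow> ('a \<Rightarrow> 'c) \<Rightarrow> bool" where
  "acyclic_coloring D S c \<longleftrightarrow>
     (\<forall>v\<in>verts D. c v \<in> S) \<and>
     (\<forall>i\<in>S. \<not> (\<exists>p. pre_digraph.cycle (D \<restriction> {v \<in> verts D. c v = i}) p))"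

text \<open>The colours are natural numbers, which is no restriction for finite colour sets.\<close>

definition acyclic_colorable :: "nat \<Rightarrow> ('a, 'b) pre_digraph \<Rightarrow> bool" where
  "acyclic_colorable k D \<longleftrightarrow>
     (\<exists>(S :: nat set) c. finite S \<and> card S = k \<and> acyclic_coloring D S c)"

definition dichromatic_number :: "('a, 'b) pre_digraph \<Rightarrow> nat" where
  "dichromatic_number D = (LEAST k. acyclic_colorable k D)"

text \<open>
  The members range over digraphs whose vertices and arcs are drawn from the types \<^typ>\<open>'a\<close> and
  \<^typ>\<open>'b\<close>. If both are infinite, every finite simple digraph occurs up to isomorphism.
\<close>

definition Forb_ind :: "('c, 'd) pre_digraph set \<Rightarrow> ('a, 'b) pre_digraph set" where
  "Forb_ind \<F> = {D. digraph D \<and> \<not> (\<exists>H F. induced_subgraph H D \<and> F \<in> \<F> \<and> digraph_iso F H)}"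

text \<open>Meaningful only if the dichromatic numbers occurring in the class are bounded.\<close>

definition class_dichromatic_number :: "('a, 'b) pre_digraph set \<Rightarrow> nat" where
  "class_dichromatic_number \<C> = Max (dichromatic_number ` \<C>)"

definition digon :: "(nat, nat \<times> nat) pre_digraph" where
  "digon = with_proj \<lparr>pverts = {0, 1}, parcs = {(0, 1), (1, 0)}\<rparr>"

definition transitive_triangle :: "(nat, nat \<times> nat) pre_digraph" where
  "transitive_triangle = with_proj \<lparr>pverts = {0, 1, 2}, parcs = {(0, 1), (0, 2), (1, 2)}\<rparr>"

definition P_plus_111 :: "(nat, nat \<times> nat) pre_digraph" where
  "P_plus_111 = with_proj \<lparr>pverts = {0, 1, 2, 3}, parcs = {(0, 1), (2, 1), (2, 3)}\<rparr>"

end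

theory Submission
  imports Defs
begin

text \<open>
  The upper bound generalises the 2-colouring of line digraphs. The vertices of the line digraph of
  a multidigraph \<open>H\<close> are the arcs of \<open>H\<close>. If \<open>H\<close> has no loops and its vertices are linearly ordered,
  then the arcs of \<open>H\<close> going up form one acyclic class and those going down another. To imitate
  this in any digraph \<open>D\<close>, split each vertex into a copy acting as a tail and a copy acting as a head,
  and join the tail copy of \<open>u\<close> to the head copy of \<open>v\<close> for every arc \<open>(u, v)\<close>. The connected components
  of this bipartite graph play the part of the vertices of \<open>H\<close>, and a vertex of \<open>D\<close> is regarded as an arc
  from the component of its head copy to the component of its tail copy. The colouring works
  whenever there are no loops, that is, whenever the two copies of a vertex never lie in the same component
  (\<open>line_digraph_labelling\<close>, \<open>two_colorable\<close>).

  This absence of loops is the heart of the proof (\<open>roles_disconnected\<close>). A loop at \<open>v\<close> is a walk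
  \<open>v = x\<^sub>0 \<rightarrow> x\<^sub>1 \<leftarrow> x\<^sub>2 \<rightarrow> \<dots> \<rightarrow> x\<^sub>n = v\<close> of odd length whose arcs alternate in direction; take \<open>n\<close> least.
  In a digraph of the class the ends of every alternating walk \<open>a \<rightarrow> b \<leftarrow> c \<rightarrow> d\<close> are adjacent. Inside the
  shortest walk such a chord cannot go from an even to an odd index, since it would be a
  shortcut, and so it goes from odd to even. The resulting chords form alternating walks themselves, and
  iterating the argument gives arcs from \<open>x\<^sub>i\<close> to \<open>x\<^sub>j\<close> for odd \<open>i\<close> and every smaller \<open>j\<close> with
  \<open>i - j\<close> congruent to 3 modulo 6. As \<open>x\<^sub>n = x\<^sub>0\<close>, each odd residue of \<open>n\<close> modulo 6 then yields a loop
  of \<open>D\<close> or a transitive triangle.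

  The directed triangle shows that 2 is attained.
\<close>

section \<open>Alternating walks\<close>

text \<open>
  \<open>Inl u\<close> is the copy of \<open>u\<close> acting as a tail, \<open>Inr v\<close> the copy of \<open>v\<close> acting as a head; a walk in this
  symmetric relation is a walk in \<open>A\<close> whose arcs alternate in direction.
\<close>

definition split_rel :: "'a rel \<Rightarrow> ('a + 'a) rel" where
  "split_rel A = {(Inl u, Inr v) |u v. (u, v) \<in> A} \<union> {(Inr v, Inl u) |u v. (u, v) \<in> A}"

lemma split_rel_simps [simp]:
  "(Inl u, Inr v) \<in> split_rel A \<longleftrightarrow> (u, v) \<in> A"
  "(Inr v, Inl u) \<in> split_rel A \<longleftrightarrow> (u, v) \<in> A"
  "(Inl u, Inl v) \<notin> split_rel A"
  "(Inr u, Inr v) \<notin> split_rel A"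
  by (auto simp: split_rel_def)

text \<open>
  The last conclusion is the whole point of taking a shortest chain: any \<open>k\<close> steps of \<open>R\<close> between
  members of the chain advance along it by at most \<open>k\<close>, as otherwise they would be a shortcut.
\<close>
lemma shortest_relpow_chain:
  assumes "(a, b) \<in> R\<^sup>*"
  obtains f n where "f 0 = a" "f n = b" "\<And>i. i < n \<Longrightarrow> (f i, f (Suc i)) \<in> R"
    and "\<And>i j k. i \<le> n \<Longrightarrow> j \<le> n \<Longrightarrow> (f i, f j) \<in> R ^^ k \<Longrightarrow> j \<le> i + k"
proof -
  define n where "n = (LEAST n. (a, b) \<in> R ^^ n)"
  have "\<exists>n. (a, b) \<in> R ^^ n"
    using assms by (rule rtrancl_imp_relpow)
  then have "(a, b) \<in> R ^^ n"
    unfolding n_def by (rule LeastI_ex)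
  then obtain f where f: "f 0 = a" "f n = b" "\<And>i. i < n \<Longrightarrow> (f i, f (Suc i)) \<in> R"
    by (auto simp: relpow_fun_conv)
  have segment: "(f i, f j) \<in> R ^^ (j - i)" if "i \<le> j" "j \<le> n" for i j
    unfolding relpow_fun_conv using that f(3) by (intro exI[of _ "\<lambda>k. f (i + k)"]) auto
  have "j \<le> i + k" if ij: "i \<le> n" "j \<le> n" and k: "(f i, f j) \<in> R ^^ k" for i j k
  proof -
    have "(a, f i) \<in> R ^^ i" "(f j, b) \<in> R ^^ (n - j)"
      using segment[of 0 i] segment[of j n] ij f(1,2) by auto
    then have "(a, b) \<in> R ^^ (i + k + (n - j))"
      using k by (auto simp: relpow_add)
    then have "n \<le> i + k + (n - j)"
      unfolding n_def by (rule Least_le)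
    then show ?thesis using ij by linarith
  qed
  with f that show thesis by blast
qed

text \<open>
  What the three forbidden digraphs amount to. The vertices in \<open>antidirected_closes\<close> may
  coincide: for \<open>a = c\<close> or \<open>b = d\<close> the conclusion repeats a premise, and \<open>a = d\<close> would make a transitive
  triangle.
\<close>
locale antidirected_closed =
  fixes A :: "'a rel"
  assumes no_digon: "(u, v) \<in> A \<Longrightarrow> (v, u) \<notin> A"
    and no_transitive_triangle: "(u, v) \<in> A \<Longrightarrow> (v, w) \<in> A \<Longrightarrow> (u, w) \<notin> A"
    and antidirected_closes:
      "(a, b) \<in> A \<Longrightarrow> (c, b) \<in> A \<Longrightarrow> (c, d) \<in> A \<Longrightarrow> (a, d) \<in> A \<or> (d, a) \<in> A"
begin

text \<open>
  The tail copy and the head copy of a vertex lie in different components, because a shortest alternating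
  walk between them has chords that close up to a loop or a transitive triangle at \<open>v\<close>.
\<close>
lemma roles_disconnected: "(Inl v, Inr v) \<notin> (split_rel A)\<^sup>*"
proof
  assume "(Inl v, Inr v) \<in> (split_rel A)\<^sup>*"
  then obtain f n where f0: "f 0 = Inl v" and fn: "f n = Inr v"
    and step: "\<And>i. i < n \<Longrightarrow> (f i, f (Suc i)) \<in> split_rel A"
    and geodesic: "\<And>i j k. i \<le> n \<Longrightarrow> j \<le> n \<Longrightarrow> (f i, f j) \<in> split_rel A ^^ k \<Longrightarrow> j \<le> i + k"
    by (rule shortest_relpow_chain) blast
  define x where "x i = (case f i of Inl u \<Rightarrow> u | Inr u \<Rightarrow> u)" for i
  have f: "f i = (if even i then Inl (x i) else Inr (x i))" if "i \<le> n" for i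
    using that
  proof (induction i)
    case 0
    then show ?case by (simp add: x_def f0)
  next
    case (Suc i)
    then have role: "f i = (if even i then Inl (x i) else Inr (x i))"
      and "(f i, f (Suc i)) \<in> split_rel A"
      using step[of i] by (blast dest: Suc_leD, force)
    moreover have "f (Suc i) = Inl (x (Suc i)) \<or> f (Suc i) = Inr (x (Suc i))"
      unfolding x_def by (cases "f (Suc i)") simp_all
    ultimately show ?case by (auto split: if_splits)
  qed
  have x0: "x 0 = v" and xn: "x n = v"
    by (simp_all add: x_def f0 fn)
  have odd_n: "odd n"
    using f[of n] fn by (auto split: if_splits)
  have up: "(x i, x (Suc i)) \<in> A" if "even i" "i < n" for i
    using step[of i] f[of i] f[of "Suc i"] that by simp
  have down: "(x (Suc i), x i) \<in> A" if "odd i" "i < n" for i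
    using step[of i] f[of i] f[of "Suc i"] that by simp
  \<comment> \<open>an arc from an even to an odd index is a step of the bipartite graph, in both directions\<close>
  have short: "\<bar>int i - int j\<bar> \<le> 1" if "even i" "odd j" "i \<le> n" "j \<le> n" "(x i, x j) \<in> A" for i j
  proof -
    have "(f i, f j) \<in> split_rel A ^^ 1" "(f j, f i) \<in> split_rel A ^^ 1"
      using f[of i] f[of j] that by auto
    then show ?thesis using geodesic[of i j 1] geodesic[of j i 1] that by linarith
  qed
  have chord_up: "(x i, x (i + 3)) \<in> A" if "odd i" "i + 3 \<le> n" for i
  proof -
    have "(x (i + 3), x (i + 2)) \<in> A" "(x (i + 1), x (i + 2)) \<in> A" "(x (i + 1), x i) \<in> A"
      using down[of "i + 2"] up[of "i + 1"] down[of i] that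
      by (simp_all add: numeral_3_eq_3)
    moreover have "(x (i + 3), x i) \<notin> A"
      using short[of "i + 3" i] that by auto
    ultimately show ?thesis using antidirected_closes by blast
  qed
  have chord_down: "(x (i + 3), x i) \<in> A" if "even i" "i + 3 \<le> n" for i
  proof -
    have "(x i, x (i + 1)) \<in> A" "(x (i + 2), x (i + 1)) \<in> A" "(x (i + 2), x (i + 3)) \<in> A"
      using up[of "i + 2"] down[of "i + 1"] up[of i] that
      by (simp_all add: numeral_3_eq_3)
    moreover have "(x i, x (i + 3)) \<notin> A"
      using short[of i "i + 3"] that by auto
    ultimately show ?thesis using antidirected_closes by blast
  qed
  \<comment> \<open>with \<open>i = j + 6 m + 3\<close>, the ends of the alternating walk
    \<open>x (i + 6) \<rightarrow> x (i + 3) \<leftarrow> x i \<rightarrow> x j\<close> are adjacent\<close>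
  have long_chord: "(x (j + 6 * m + 3), x j) \<in> A" if "even j" "j + 6 * m + 3 \<le> n" for j m
    using that
  proof (induction m)
    case 0
    then show ?case using chord_down by simp
  next
    case (Suc m)
    let ?i = "j + 6 * m + 3"
    have "(x (?i + 6), x (?i + 3)) \<in> A" "(x ?i, x (?i + 3)) \<in> A" "(x ?i, x j) \<in> A"
      using chord_down[of "?i + 3"] chord_up[of ?i] Suc by simp_all
    moreover have "(x j, x (?i + 6)) \<notin> A"
      using short[of j "?i + 6"] Suc.prems by auto
    ultimately have "(x (?i + 6), x j) \<in> A" using antidirected_closes by blast
    moreover have "?i + 6 = j + 6 * Suc m + 3" by simp
    ultimately show ?case by metis
  qed
  have n6: "n = 6 * (n div 6) + n mod 6" by simp
  have "n mod 6 = 1 \<or> n mod 6 = 3 \<or> n mod 6 = 5"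
    using odd_n by presburger
  then consider m where "n = 6 * m + 3" | m where "n = 6 * m + 5" | "n = 1"
    | m where "n = 6 * m + 7"
  proof -
    assume "n mod 6 = 1 \<or> n mod 6 = 3 \<or> n mod 6 = 5"
    then show thesis
      using that(1)[of "n div 6"] that(2)[of "n div 6"] that(3) that(4)[of "n div 6 - 1"] n6
      by (cases "n div 6") auto
  qed
  then show False
  proof cases
    case 1
    then have "(v, v) \<in> A" using long_chord[of 0 m] x0 xn by simp
    then show False using no_digon by blast
  next
    case 2
    then have "(v, x 2) \<in> A" using long_chord[of 2 m] xn by (simp add: algebra_simps)
    moreover have "(x 2, x 1) \<in> A" "(v, x 1) \<in> A"
      using 2 down[of 1] up[of 0] x0 by (simp_all add: numeral_2_eq_2)
    ultimately show False using no_transitive_triangle by blast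
  next
    case 3
    then have "(v, v) \<in> A" using up[of 0] x0 xn by simp
    then show False using no_digon by blast
  next
    case 4
    then have "(v, x 4) \<in> A" using long_chord[of 4 m] xn by (simp add: algebra_simps)
    moreover have "(v, x 1) \<in> A" "(x 1, x 4) \<in> A"
      using 4 chord_up[of 1] up[of 0] x0 by simp_all
    ultimately show False using no_transitive_triangle by blast
  qed
qed

text \<open>
  \<open>\<phi>\<close> and \<open>\<psi>\<close> number the components of the tail copy and of the head copy. Thus \<open>v\<close> becomes an arc from
  \<open>\<psi> v\<close> to \<open>\<phi> v\<close> of a loopless multidigraph, and an arc of \<open>A\<close> joins two consecutive arcs of it.
\<close>
lemma line_digraph_labelling:
  assumes "finite V"  "A \<subseteq> V \<times> V"
  obtains \<phi> \<psi> :: "'a \<Rightarrow> nat"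
  where "\<And>u v. (u, v) \<in> A \<Longrightarrow> \<phi> u = \<psi> v" "\<And>v. v \<in> V \<Longrightarrow> \<phi> v \<noteq> \<psi> v"
proof -
  define comp where "comp s = (split_rel A)\<^sup>* `` {s}" for s
  have "finite (comp ` (Inl ` V \<union> Inr ` V))"
    using assms(1) by simp
  then obtain h :: "('a + 'a) set \<Rightarrow> nat" where h: "inj_on h (comp ` (Inl ` V \<union> Inr ` V))"
    using finite_imp_inj_to_nat_seg by meson
  show thesis
  proof
    fix u v assume "(u, v) \<in> A"
    then have "(Inl u, Inr v) \<in> split_rel A" "(Inr v, Inl u) \<in> split_rel A"
      by simp_all
    then have "comp (Inl u) = comp (Inr v)"
      unfolding comp_def by (blast intro: converse_rtrancl_into_rtrancl)
    then show "h (comp (Inl u)) = h (comp (Inr v))" by simp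
  next
    fix v assume v: "v \<in> V"
    show "h (comp (Inl v)) \<noteq> h (comp (Inr v))"
    proof
      assume "h (comp (Inl v)) = h (comp (Inr v))"
      with h v have "comp (Inl v) = comp (Inr v)"
        by (meson UnI1 UnI2 imageI inj_onD)
      then have "(Inl v, Inr v) \<in> (split_rel A)\<^sup>*"
        unfolding comp_def by blast
      then show False using roles_disconnected by blast
    qed
  qed
qed

end

section \<open>Two colours suffice\<close>

lemma no_cycle_if_arcs_increase:
  fixes \<phi> :: "'a \<Rightarrow> int"
  assumes "\<And>e. e \<in> arcs D \<Longrightarrow> \<phi> (tail D e) < \<phi> (head D e)"
  shows "\<not> pre_digraph.cycle D p"
proof
  assume "pre_digraph.cycle D p"
  then obtain u where "pre_digraph.cas D u p u" "set p \<subseteq> arcs D" "p \<noteq> []"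
    by (auto simp: pre_digraph.cycle_def pre_digraph.awalk_def)
  moreover have "\<phi> u + int (length p) \<le> \<phi> w"
    if "pre_digraph.cas D u p w" "set p \<subseteq> arcs D" for u w
    using that
  proof (induction p arbitrary: u)
    case Nil
    then show ?case by (simp add: pre_digraph.cas.simps)
  next
    case (Cons e p)
    then show ?case
      using assms[of e] Cons.IH[of "head D e"] by (fastforce simp: pre_digraph.cas.simps)
  qed
  ultimately show False by force
qed

text \<open>
  Colour \<open>v\<close> by whether the step from \<open>\<psi> v\<close> to \<open>\<phi> v\<close> goes up or down. Since \<open>\<phi> u = \<psi> v\<close> on every arc
  \<open>(u, v)\<close>, the label \<open>\<phi>\<close> is strictly monotone along directed walks within a colour class.
\<close>
lemma (in fin_digraph) two_colorable:
  assumes "antidirected_closed (arcs_ends G)"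
  shows "acyclic_colorable 2 G"
proof -
  interpret antidirected_closed "arcs_ends G" by fact
  have "arcs_ends G \<subseteq> verts G \<times> verts G"
    using adj_in_verts by auto
  then obtain \<phi> \<psi> :: "'a \<Rightarrow> nat"
    where arc: "\<And>u v. u \<rightarrow>\<^bsub>G\<^esub> v \<Longrightarrow> \<phi> u = \<psi> v"
      and distinct: "\<And>v. v \<in> verts G \<Longrightarrow> \<phi> v \<noteq> \<psi> v"
    using line_digraph_labelling finite_verts by metis
  define c :: "'a \<Rightarrow> nat" where "c v = (if \<psi> v < \<phi> v then 0 else 1)" for v
  have ends: "\<phi> (tail G e) = \<psi> (head G e)" if "e \<in> arcs G" for e
    using that by (intro arc) (auto simp: arcs_ends_conv)
  have acyclic: "\<not> pre_digraph.cycle (G \<restriction> {v \<in> verts G. c v = i}) p" if "i \<in> {0, 1}" for i p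
  proof (cases "i = 0")
    case True
    then show ?thesis
      by (intro no_cycle_if_arcs_increase[where \<phi> = "\<lambda>v. int (\<phi> v)"])
        (auto simp: ends c_def split: if_splits)
  next
    case False
    have "\<phi> (head G e) < \<phi> (tail G e)"
      if "e \<in> arcs G" "c (tail G e) = 1" "c (head G e) = 1" for e
    proof -
      have "\<not> \<psi> (head G e) < \<phi> (head G e)"
        using that(3) by (simp add: c_def split: if_splits)
      moreover have "\<phi> (head G e) \<noteq> \<psi> (head G e)"
        using that(1) distinct by simp
      ultimately show ?thesis
        using ends[OF that(1)] by linarith
    qed
    with False \<open>i \<in> {0, 1}\<close> show ?thesis
      by (intro no_cycle_if_arcs_increase[where \<phi> = "\<lambda>v. - int (\<phi> v)"]) auto
  qed
  have "acyclic_coloring G {0, 1} c"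
    unfolding acyclic_coloring_def using acyclic by (auto simp: c_def)
  then show ?thesis
    unfolding acyclic_colorable_def by (intro exI[of _ "{0, 1}"]) auto
qed

section \<open>Induced copies of a pattern\<close>

text \<open>
  A vertex map that preserves and reflects adjacency extends to the arcs, since an arc is determined
  by its ends. The next two lemmas reduce containment of a pattern to statements about vertices.
\<close>
lemma (in nomulti_digraph) induced_copyI:
  assumes "inj_on f (pverts P)" "f ` pverts P \<subseteq> verts G" "parcs P \<subseteq> pverts P \<times> pverts P"
    and arcs_iff: "\<And>x y. x \<in> pverts P \<Longrightarrow> y \<in> pverts P \<Longrightarrow> f x \<rightarrow>\<^bsub>G\<^esub> f y \<longleftrightarrow> (x, y) \<in> parcs P"
  shows "\<exists>H. induced_subgraph H G \<and> digraph_iso (with_proj P) H"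
proof -
  let ?H = "G \<restriction> (f ` pverts P)"
  have "\<exists>e. e \<in> arcs G \<and> tail G e = f (fst xy) \<and> head G e = f (snd xy)"
    if "xy \<in> parcs P" for xy
  proof -
    have "f (fst xy) \<rightarrow>\<^bsub>G\<^esub> f (snd xy)"
      using that assms(3) by (subst arcs_iff) auto
    then show ?thesis by (rule reachableE) blast
  qed
  then obtain arc_of where arc_of:
    "\<And>xy. xy \<in> parcs P \<Longrightarrow>
      arc_of xy \<in> arcs G \<and> tail G (arc_of xy) = f (fst xy) \<and> head G (arc_of xy) = f (snd xy)"
    by metis
  define hom where
    "hom = \<lparr>iso_verts = f, iso_arcs = arc_of, iso_head = head G, iso_tail = tail G\<rparr>"
  have arcs: "arc_of ` parcs P = arcs ?H"
  proof (intro equalityI subsetI)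
    fix e assume "e \<in> arc_of ` parcs P"
    then show "e \<in> arcs ?H" using arc_of assms(3) by fastforce
  next
    fix e assume "e \<in> arcs ?H"
    then obtain x y where xy: "x \<in> pverts P" "y \<in> pverts P" "tail G e = f x" "head G e = f y"
      and e: "e \<in> arcs G" by auto
    then have "f x \<rightarrow>\<^bsub>G\<^esub> f y"
      by (intro dominatesI[where a = e]) (simp_all add: arc_to_ends_def)
    with xy have P: "(x, y) \<in> parcs P" using arcs_iff by blast
    then have "e = arc_of (x, y)"
      using arc_of[OF P] e xy by (intro no_multi_arcs) (auto simp: arc_to_ends_def)
    with P show "e \<in> arc_of ` parcs P" by blast
  qed
  have "inj_on arc_of (parcs P)"
  proof (rule inj_onI)
    fix p q assume pq: "p \<in> parcs P" "q \<in> parcs P" "arc_of p = arc_of q"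
    then have "f (fst p) = f (fst q)" "f (snd p) = f (snd q)"
      using arc_of by metis+
    moreover have "fst p \<in> pverts P" "fst q \<in> pverts P" "snd p \<in> pverts P" "snd q \<in> pverts P"
      using pq(1,2) assms(3) by auto
    ultimately show "p = q"
      using assms(1) by (metis inj_onD prod.expand)
  qed
  moreover have "wf_digraph (with_proj P)"
    using assms(3) by unfold_locales auto
  ultimately have "pre_digraph.digraph_isomorphism (with_proj P) hom"
    using assms(1) arc_of by (auto simp: pre_digraph.digraph_isomorphism_def hom_def)
  moreover have "?H = app_iso hom (with_proj P)"
    using arcs by (auto intro!: pre_digraph.equality simp: hom_def)
  moreover have "induced_subgraph ?H G"
    using assms(2) by (rule induced_induce)
  ultimately show ?thesis unfolding digraph_iso_def by blast
qed

lemma induced_copyD: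
  assumes "induced_subgraph H G" "digraph_iso (with_proj P) H"
  shows "\<exists>f. inj_on f (pverts P) \<and> (\<forall>(x, y)\<in>parcs P. f x \<rightarrow>\<^bsub>G\<^esub> f y)"
proof -
  from assms(2) obtain hom where hom: "pre_digraph.digraph_isomorphism (with_proj P) hom"
    and H: "H = app_iso hom (with_proj P)"
    by (auto simp: digraph_iso_def)
  have "iso_verts hom x \<rightarrow>\<^bsub>G\<^esub> iso_verts hom y" if "(x, y) \<in> parcs P" for x y
  proof -
    have "iso_verts hom x \<rightarrow>\<^bsub>H\<^esub> iso_verts hom y"
      using hom that unfolding H arcs_ends_conv
      by (force simp: pre_digraph.digraph_isomorphism_def)
    moreover have "subgraph H G" using assms(1) by auto
    ultimately show ?thesis
      by (fastforce simp: arcs_ends_conv subgraph_def compatible_def)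
  qed
  then show ?thesis
    using hom by (intro exI[of _ "iso_verts hom"]) (auto simp: pre_digraph.digraph_isomorphism_def)
qed

lemma antidirected_closed_if_forbidden:
  assumes "D \<in> Forb_ind {digon, P_plus_111, transitive_triangle}"
  shows "antidirected_closed (arcs_ends D)"
proof -
  interpret digraph D using assms by (simp add: Forb_ind_def)
  have free: "\<not> (\<exists>H. induced_subgraph H D \<and> digraph_iso F H)"
    if "F \<in> {digon, P_plus_111, transitive_triangle}" for F
    using assms that unfolding Forb_ind_def by blast
  have loop: "\<not> u \<rightarrow>\<^bsub>D\<^esub> u" for u
    using adj_not_same by blast
  have digon_free: "\<not> v \<rightarrow>\<^bsub>D\<^esub> u" if "u \<rightarrow>\<^bsub>D\<^esub> v" for u v
  proof
    assume "v \<rightarrow>\<^bsub>D\<^esub> u"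
    moreover have "u \<in> verts D" "v \<in> verts D" "u \<noteq> v"
      using that adj_in_verts loop by blast+
    ultimately have "\<exists>H. induced_subgraph H D \<and> digraph_iso digon H"
      unfolding digon_def using that loop
      by (intro induced_copyI[where f = "(\<lambda>_. u)(1 := v)"]) auto
    then show False using free by simp
  qed
  have triangle_free: "\<not> u \<rightarrow>\<^bsub>D\<^esub> w" if "u \<rightarrow>\<^bsub>D\<^esub> v" "v \<rightarrow>\<^bsub>D\<^esub> w" for u v w
  proof
    assume "u \<rightarrow>\<^bsub>D\<^esub> w"
    moreover from this that have "u \<in> verts D" "v \<in> verts D" "w \<in> verts D"
      and "u \<noteq> v" "v \<noteq> w" "u \<noteq> w"
      and "\<not> v \<rightarrow>\<^bsub>D\<^esub> u" "\<not> w \<rightarrow>\<^bsub>D\<^esub> v" "\<not> w \<rightarrow>\<^bsub>D\<^esub> u"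
      using adj_in_verts loop digon_free by blast+
    ultimately have "\<exists>H. induced_subgraph H D \<and> digraph_iso transitive_triangle H"
      unfolding transitive_triangle_def using that loop
      by (intro induced_copyI[where f = "(\<lambda>_. u)(1 := v, 2 := w)"]) (auto simp: inj_on_def)
    then show False using free by simp
  qed
  have "a \<rightarrow>\<^bsub>D\<^esub> d \<or> d \<rightarrow>\<^bsub>D\<^esub> a" if arcs: "a \<rightarrow>\<^bsub>D\<^esub> b" "c \<rightarrow>\<^bsub>D\<^esub> b" "c \<rightarrow>\<^bsub>D\<^esub> d" for a b c d
  proof (rule ccontr)
    assume nonadj: "\<not> (a \<rightarrow>\<^bsub>D\<^esub> d \<or> d \<rightarrow>\<^bsub>D\<^esub> a)"
    then have "a \<noteq> c" "b \<noteq> d" "a \<noteq> d"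
      using arcs triangle_free by blast+
    moreover have "a \<noteq> b" "c \<noteq> b" "c \<noteq> d"
      using arcs loop by auto
    moreover have "\<not> a \<rightarrow>\<^bsub>D\<^esub> c" "\<not> c \<rightarrow>\<^bsub>D\<^esub> a" "\<not> b \<rightarrow>\<^bsub>D\<^esub> d" "\<not> d \<rightarrow>\<^bsub>D\<^esub> b"
      "\<not> b \<rightarrow>\<^bsub>D\<^esub> a" "\<not> b \<rightarrow>\<^bsub>D\<^esub> c" "\<not> d \<rightarrow>\<^bsub>D\<^esub> c"
      using arcs triangle_free digon_free by blast+
    moreover have "a \<in> verts D" "b \<in> verts D" "c \<in> verts D" "d \<in> verts D"
      using arcs adj_in_verts by blast+
    ultimately have "\<exists>H. induced_subgraph H D \<and> digraph_iso P_plus_111 H"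
      unfolding P_plus_111_def using loop arcs nonadj
      by (intro induced_copyI[where f = "(\<lambda>_. a)(1 := b, 2 := c, 3 := d)"])
        (auto simp: inj_on_def)
    then show False using free by simp
  qed
  with digon_free triangle_free show ?thesis
    unfolding antidirected_closed_def by blast
qed

section \<open>The directed triangle\<close>

lemma obtain_three:
  assumes "infinite (UNIV :: 'a set)"
  obtains a b c :: 'a where "distinct [a, b, c]"
proof -
  obtain T :: "'a set" where "card T = 3"
    using infinite_arbitrarily_large[OF assms] by blast
  then show thesis using that by (auto simp: card_3_iff)
qed

text \<open>
  The directed triangle belongs to the class because all its out-degrees are 1 and it has no digon,
  whereas the other two patterns have a vertex of out-degree 2. It is itself a cycle, so one colour
  is not enough.
\<close>
lemma directed_triangle_in_class:
  assumes "infinite (UNIV :: 'a set)" "infinite (UNIV :: 'b set)"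
  obtains D :: "('a, 'b) pre_digraph"
  where "D \<in> Forb_ind {digon, P_plus_111, transitive_triangle}"
    and "\<And>k. acyclic_colorable k D \<Longrightarrow> 2 \<le> k"
proof -
  obtain x y z :: 'a where xyz: "distinct [x, y, z]"
    using obtain_three[OF assms(1)] .
  obtain p q r :: 'b where pqr: "distinct [p, q, r]"
    using obtain_three[OF assms(2)] .
  define D :: "('a, 'b) pre_digraph" where
    "D = \<lparr>verts = {x, y, z}, arcs = {p, q, r},
          tail = (\<lambda>_. x)(q := y, r := z), head = (\<lambda>_. x)(p := y, q := z)\<rparr>"
  have D [simp]: "verts D = {x, y, z}" "arcs D = {p, q, r}"
    "tail D p = x" "tail D q = y" "tail D r = z" "head D p = y" "head D q = z" "head D r = x"
    using pqr by (auto simp: D_def)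
  interpret digraph D
    using xyz by unfold_locales (auto simp: arc_to_ends_def)
  have ends: "arcs_ends D = {(x, y), (y, z), (z, x)}"
    by (simp add: arcs_ends_conv)
  have functional: "v = w" if "u \<rightarrow>\<^bsub>D\<^esub> v" "u \<rightarrow>\<^bsub>D\<^esub> w" for u v w
    using that xyz by (auto simp: ends)
  have no_copy: False
    if H: "induced_subgraph H D" and F: "F \<in> {digon, P_plus_111, transitive_triangle}"
      and iso: "digraph_iso F H" for H F
  proof -
    from F consider "F = digon" | "F = P_plus_111" | "F = transitive_triangle" by blast
    then show False
    proof cases
      case 1
      with iso have "digraph_iso digon H" by simp
      from induced_copyD[OF H this[unfolded digon_def]] obtain f :: "nat \<Rightarrow> 'a" where "f 0 \<rightarrow>\<^bsub>D\<^esub> f 1" "f 1 \<rightarrow>\<^bsub>D\<^esub> f 0"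
        by auto
      then show False using xyz by (auto simp: ends)
    next
      case 2
      with iso have "digraph_iso P_plus_111 H" by simp
      from induced_copyD[OF H this[unfolded P_plus_111_def]] obtain f :: "nat \<Rightarrow> 'a"
        where f: "inj_on f {0, 1, 2, 3}" "f 2 \<rightarrow>\<^bsub>D\<^esub> f 1" "f 2 \<rightarrow>\<^bsub>D\<^esub> f 3"
        by auto
      from functional[OF f(2,3)] f(1) show False by (simp add: inj_on_def)
    next
      case 3
      with iso have "digraph_iso transitive_triangle H" by simp
      from induced_copyD[OF H this[unfolded transitive_triangle_def]] obtain f :: "nat \<Rightarrow> 'a"
        where f: "inj_on f {0, 1, 2}" "f 0 \<rightarrow>\<^bsub>D\<^esub> f 1" "f 0 \<rightarrow>\<^bsub>D\<^esub> f 2"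
        by auto
      from functional[OF f(2,3)] f(1) show False by (simp add: inj_on_def)
    qed
  qed
  have "D \<in> Forb_ind {digon, P_plus_111, transitive_triangle}"
    using no_copy digraph_axioms unfolding Forb_ind_def by blast
  moreover have "2 \<le> k" if "acyclic_colorable k D" for k
  proof (rule ccontr)
    assume "\<not> 2 \<le> k"
    from that obtain S :: "nat set" and c where S: "finite S" "card S = k"
      and c: "\<forall>v\<in>verts D. c v \<in> S"
      and acyclic: "\<And>i p. i \<in> S \<Longrightarrow> \<not> pre_digraph.cycle (D \<restriction> {v \<in> verts D. c v = i}) p"
      unfolding acyclic_colorable_def acyclic_coloring_def by blast
    have "c y = c x" "c z = c x"
      using S c \<open>\<not> 2 \<le> k\<close> card_le_Suc0_iff_eq[OF S(1)] by auto
    then have "{v \<in> verts D. c v = c x} = {x, y, z}" by auto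
    moreover have "pre_digraph.cycle (D \<restriction> {x, y, z}) [p, q, r]"
      unfolding pre_digraph.cycle_def pre_digraph.awalk_def
      using xyz by (auto simp: pre_digraph.cas.simps pre_digraph.awalk_verts.simps)
    ultimately show False using acyclic[of "c x"] c by auto
  qed
  ultimately show thesis using that by blast
qed

theorem theorem5:
  fixes \<C> :: "('a, 'b) pre_digraph set"
  assumes "infinite (UNIV :: 'a set)" and "infinite (UNIV :: 'b set)"
    and "\<C> = Forb_ind {digon, P_plus_111, transitive_triangle}"
  shows "bdd_above (dichromatic_number ` \<C>) \<and> class_dichromatic_number \<C> = 2"
proof -
  have colorable: "acyclic_colorable 2 D" if "D \<in> \<C>" for D
  proof -
    interpret digraph D using that assms(3) by (simp add: Forb_ind_def)
    show ?thesis
      using two_colorable antidirected_closed_if_forbidden that assms(3) by blast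
  qed
  then have upper: "n \<le> 2" if "n \<in> dichromatic_number ` \<C>" for n
    using that by (auto simp: dichromatic_number_def intro: Least_le)
  obtain D :: "('a, 'b) pre_digraph" where D: "D \<in> \<C>"
    and lower: "\<And>k. acyclic_colorable k D \<Longrightarrow> 2 \<le> k"
    using directed_triangle_in_class[OF assms(1,2)] assms(3) by metis
  have "dichromatic_number D = 2"
    unfolding dichromatic_number_def using colorable[OF D] lower by (rule Least_equality)
  with D have attained: "2 \<in> dichromatic_number ` \<C>" by force
  have "finite (dichromatic_number ` \<C>)"
    using upper by (auto intro: finite_subset[of _ "{..2}"])
  then have "class_dichromatic_number \<C> = 2"
    unfolding class_dichromatic_number_def using upper attained by (intro Max_eqI) auto
  moreover have "bdd_above (dichromatic_number ` \<C>)"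
    using upper by (rule bdd_aboveI)
  ultimately show ?thesis by blast
qed

end
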